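(* Let $u$ and $v$ be two adjacent vertices of a connected graph $G$. For integers $k$ and $l$, let $G_{k,l}$ denote the graph obtained from $G$ by adding a path of length $k$ at $u$ and a path of length $l$ at $v$. If $k>l\geqslant 1$, then $\Lambda_1(G_{k,l})<\Lambda_1(G_{k+1,l-1})$. If $k=l\geqslant 1$, then $\Lambda_1(G_{k,l})<\Lambda_1(G_{k+1,l-1})$ or $\Lambda_1(G_{k,l})<\Lambda_1(G_{k-1,l+1})$.
   Context: All graphs are finite, simple and connected. For a connected graph $H$ with vertex set $\{1,\ldots,n\}$, $\mathrm{dist}(i,j)$ is the number of edges of a shortest path from $i$ to $j$, and the distance matrix $D(H)$ is the $n\times n$ matrix with $(i,j)$-entry $\mathrm{dist}(i,j)$. The distance spectral radius $\Lambda_1(H)$ is the eigenvalue of $D(H)$ of largest magnitude. Adding a path of length $k$ at a vertex $u$ means adjoining $k$ new vertices $p_1,\ldots,p_k$ and the edges $up_1,p_1p_2,\ldots,p_{k-1}p_k$ (the paths added at $u$ and $v$ use disjoint sets of new vertices). Adding a path of length $0$ means adding nothing.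
   Formalization: The formal theorem assumes that G has at least 3 vertices, i.e. G is not the single edge K_2; for G = K_2 all the graphs compared are the same path on k+l+2 vertices, so the strict inequalities fail. *)

theory Defs
  imports "Graph_Theory.Graph_Theory" "Jordan_Normal_Form.Spectral_Radius"
begin

text \<open>
  A finite simple graph on \<open>n\<close> vertices is a \<open>pair_graph\<close> with vertex set \<open>{0..<n}\<close>: an undirected
  edge is the pair of its two opposite arcs. The numbering starts at 0 to agree with the indices
  of \<open>mat\<close>; the distance matrix below presupposes this vertex set.
\<close>

text \<open>With unit costs the library's \<open>\<mu>\<close> is the number of edges of a shortest walk, hence of a
  shortest path; it is finite whenever the graph is connected.\<close>
definition graph_dist :: "nat pair_pre_digraph \<Rightarrow> nat \<Rightarrow> nat \<Rightarrow> real" where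
  "graph_dist H i j = real_of_ereal (wf_digraph.\<mu> (with_proj H) (\<lambda>_. 1) i j)"

definition distance_matrix :: "nat pair_pre_digraph \<Rightarrow> real mat" where
  "distance_matrix H =
     mat (card (pverts H)) (card (pverts H)) (\<lambda>(i, j). graph_dist H i j)"

text \<open>
  The eigenvalue of largest magnitude. The matrix is real symmetric, so its real spectrum contains
  all its eigenvalues. Two eigenvalues of largest magnitude can differ only in sign
  (\<open>1\<close> and \<open>-1\<close> for the graph with one edge); \<open>Max\<close> then picks the positive one.
\<close>
definition distance_spectral_radius :: "nat pair_pre_digraph \<Rightarrow> real" where
  "distance_spectral_radius H =
     Max {x \<in> spectrum (distance_matrix H). \<forall>y \<in> spectrum (distance_matrix H). \<bar>y\<bar> \<le> \<bar>x\<bar>}"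

text \<open>The \<open>i\<close>-th vertex of the path added at \<open>u\<close>: it starts in \<open>u\<close> itself, and the new vertices are
  \<open>n\<close>, \<open>n + 1\<close>, and so on, where \<open>n\<close> is the number of old vertices.\<close>
definition path_vertex :: "nat \<Rightarrow> nat \<Rightarrow> nat \<Rightarrow> nat" where
  "path_vertex n u i = (if i = 0 then u else n + (i - 1))"

text \<open>The new vertices are fresh because the graph has vertex set \<open>{0..<n}\<close>; the result has vertex
  set \<open>{0..<n + k}\<close>, so that another path can be added to it.\<close>
definition add_path :: "nat pair_pre_digraph \<Rightarrow> nat \<Rightarrow> nat \<Rightarrow> nat pair_pre_digraph" where
  "add_path G u k = (let n = card (pverts G); p = path_vertex n u in
     \<lparr> pverts = pverts G \<union> {n..<n + k},
       parcs = parcs G \<union> (\<Union>i<k. {(p i, p (Suc i)), (p (Suc i), p i)}) \<rparr>)"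

definition add_two_paths ::
  "nat pair_pre_digraph \<Rightarrow> nat \<Rightarrow> nat \<Rightarrow> nat \<Rightarrow> nat \<Rightarrow> nat pair_pre_digraph" where
  "add_two_paths G u v k l = add_path (add_path G u k) v l"

end

theory Submission
  imports Defs "HOL-Analysis.Function_Topology"
begin

text \<open>
  View the two added paths together with the edge \<open>uv\<close> as one long path. Replacing \<open>(k, l)\<close> by
  \<open>(k + 1, l - 1)\<close> slides the rest \<open>A\<close> of \<open>G\<close> one step along it: the distances from \<open>A\<close> to the
  path vertices on the side of \<open>u\<close> grow by 1, those on the side of \<open>v\<close> drop by at most 1, and no
  other distance changes. If \<open>x\<close> is the Perron vector of the old graph, its Rayleigh quotient
  does not decrease as soon as \<open>x\<close> has at least as much weight on the \<open>u\<close>-side as on the \<open>v\<close>-side;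
  the spectral radius then grows strictly, because the row of the far end of the path changes and
  \<open>x\<close> is no longer an eigenvector. For \<open>k = l\<close> one of the two directions satisfies the weight
  condition. For \<open>k > l\<close> compare the path vertices lying symmetrically about \<open>u\<close>: their eigenvalue
  equations give a second-order recurrence that excludes a deficit on the \<open>u\<close>-side.
\<close>

section \<open>The Perron vector of a distance matrix\<close>

text \<open>Functions on an arbitrary finite index set take the place of matrices, so that two
  graphs with different vertex numberings can be compared over one common index set.\<close>

definition matvec :: "'i set \<Rightarrow> ('i \<Rightarrow> 'i \<Rightarrow> real) \<Rightarrow> ('i \<Rightarrow> real) \<Rightarrow> 'i \<Rightarrow> real" where
  "matvec I D x i = (\<Sum>j\<in>I. D i j * x j)"

definition qform :: "'i set \<Rightarrow> ('i \<Rightarrow> 'i \<Rightarrow> real) \<Rightarrow> ('i \<Rightarrow> real) \<Rightarrow> real" where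
  "qform I D x = (\<Sum>i\<in>I. x i * matvec I D x i)"

lemma qform_eq_scale:
  assumes "\<And>i. i \<in> I \<Longrightarrow> matvec I D x i = r * x i"
  shows "qform I D x = r * (\<Sum>i\<in>I. (x i)\<^sup>2)"
  unfolding qform_def sum_distrib_left
  by (rule sum.cong) (use assms in \<open>auto simp: power2_eq_square\<close>)

text \<open>Triangle inequality, applied twice. It reduces the search for a maximizer to nonnegative
  vectors and later bounds negative eigenvalues too.\<close>

lemma qform_abs_le:
  assumes "\<And>i j. i \<in> I \<Longrightarrow> j \<in> I \<Longrightarrow> 0 \<le> D i j"
  shows "\<bar>qform I D y\<bar> \<le> qform I D (\<lambda>i. \<bar>y i\<bar>)"
proof -
  have "\<bar>qform I D y\<bar> \<le> (\<Sum>i\<in>I. \<bar>y i * matvec I D y i\<bar>)"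
    unfolding qform_def by (rule sum_abs)
  also have "\<dots> \<le> qform I D (\<lambda>i. \<bar>y i\<bar>)"
    unfolding qform_def
  proof (rule sum_mono)
    fix i assume i: "i \<in> I"
    have "\<bar>matvec I D y i\<bar> \<le> (\<Sum>j\<in>I. \<bar>D i j * y j\<bar>)"
      unfolding matvec_def by (rule sum_abs)
    also have "\<dots> = matvec I D (\<lambda>i. \<bar>y i\<bar>) i"
      unfolding matvec_def by (rule sum.cong) (use assms i in \<open>auto simp: abs_mult\<close>)
    finally show "\<bar>y i * matvec I D y i\<bar> \<le> \<bar>y i\<bar> * matvec I D (\<lambda>i. \<bar>y i\<bar>) i"
      by (simp add: abs_mult mult_left_mono)
  qed
  finally show ?thesis .
qed

lemma qform_scale: "qform I D (\<lambda>i. c * x i) = c\<^sup>2 * qform I D x"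
  unfolding qform_def matvec_def sum_distrib_left
  by (intro sum.cong refl) (simp add: power2_eq_square algebra_simps)

lemma qform_add:
  assumes "\<And>i j. i \<in> I \<Longrightarrow> j \<in> I \<Longrightarrow> D i j = D j i"
  shows "qform I D (\<lambda>i. x i + y i) = qform I D x + 2 * (\<Sum>i\<in>I. y i * matvec I D x i) + qform I D y"
proof -
  have "(\<Sum>i\<in>I. x i * matvec I D y i) = (\<Sum>i\<in>I. \<Sum>j\<in>I. x i * (D i j * y j))"
    unfolding matvec_def sum_distrib_left ..
  also have "\<dots> = (\<Sum>j\<in>I. \<Sum>i\<in>I. x i * (D i j * y j))"
    by (rule sum.swap)
  also have "\<dots> = (\<Sum>i\<in>I. y i * matvec I D x i)"
    unfolding matvec_def sum_distrib_left
    by (intro sum.cong refl) (use assms in \<open>auto simp: algebra_simps\<close>)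
  finally show ?thesis
    unfolding qform_def matvec_def by (simp add: sum.distrib algebra_simps)
qed

text \<open>Perturbing coordinate \<open>i\<close> of \<open>x\<close> by \<open>t\<close> turns
  \<open>le\<close> into \<open>2 * t * c + t\<^sup>2 * b \<le> 0\<close> for all \<open>t\<close>,
  where \<open>c\<close> is the defect of the eigenvalue equation in row \<open>i\<close>; this
  forces \<open>c = 0\<close>.\<close>

lemma rayleigh_maximizer_eigenvector:
  assumes "finite I" and sym: "\<And>i j. i \<in> I \<Longrightarrow> j \<in> I \<Longrightarrow> D i j = D j i"
    and le: "\<And>y. qform I D y \<le> r * (\<Sum>i\<in>I. (y i)\<^sup>2)"
    and eq: "qform I D x = r * (\<Sum>i\<in>I. (x i)\<^sup>2)"
    and i: "i \<in> I"
  shows "matvec I D x i = r * x i"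
proof -
  define e where "e = (\<lambda>j. if j = i then 1 else 0 :: real)"
  define c where "c = matvec I D x i - r * x i"
  define b where "b = D i i - r"
  have sum_e: "(\<Sum>j\<in>I. e j * f j) = f i" for f
    using assms(1) i by (simp add: e_def if_distrib[of "\<lambda>x. x * _"] cong: if_cong)
  have qe: "qform I D e = D i i"
    using assms(1) i sum_e[of "\<lambda>j. matvec I D e j"] sum_e[of "\<lambda>j. D i j"]
    by (simp add: qform_def matvec_def mult.commute)
  have quad: "2 * t * c + t\<^sup>2 * b \<le> 0" for t
  proof -
    have "qform I D (\<lambda>j. x j + t * e j)
        = qform I D x + 2 * (\<Sum>j\<in>I. t * e j * matvec I D x j) + t\<^sup>2 * D i i"
      by (simp add: qform_add[OF sym] qform_scale qe)
    also have "(\<Sum>j\<in>I. t * e j * matvec I D x j) = t * matvec I D x i"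
      using sum_e[of "\<lambda>j. t * matvec I D x j"] by (simp add: algebra_simps)
    finally have 1: "qform I D (\<lambda>j. x j + t * e j) = qform I D x + 2 * (t * matvec I D x i) + t\<^sup>2 * D i i" .
    have "(\<Sum>j\<in>I. (x j + t * e j)\<^sup>2) = (\<Sum>j\<in>I. (x j)\<^sup>2 + (e j * (2 * t * x j) + e j * t\<^sup>2))"
      by (rule sum.cong) (auto simp: e_def power2_eq_square algebra_simps)
    also have "\<dots> = (\<Sum>j\<in>I. (x j)\<^sup>2) + (2 * t * x i + t\<^sup>2)"
      by (simp add: sum.distrib sum_e)
    finally have 2: "(\<Sum>j\<in>I. (x j + t * e j)\<^sup>2) = (\<Sum>j\<in>I. (x j)\<^sup>2) + (2 * t * x i + t\<^sup>2)" .
    show ?thesis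
      using le[of "\<lambda>j. x j + t * e j"] unfolding 1 2 eq c_def b_def by (simp add: algebra_simps)
  qed
  \<comment> \<open>A step with the sign of \<open>c\<close>, short enough for the linear term to
    dominate the quadratic one.\<close>
  define t where "t = c / (\<bar>b\<bar> + 1)"
  have c: "c = t * (\<bar>b\<bar> + 1)"
    by (simp add: t_def add_nonneg_eq_0_iff)
  have "t\<^sup>2 * (2 * (\<bar>b\<bar> + 1) + b) \<le> 0"
    using quad[of t] unfolding c by (simp add: power2_eq_square algebra_simps)
  moreover have "2 * (\<bar>b\<bar> + 1) + b > 0"
    by simp
  ultimately have "t = 0"
    by (smt (verit) mult_pos_pos zero_less_power2)
  then show ?thesis
    using c by (simp add: c_def)
qed

text \<open>Compactness of the nonnegative part of the unit sphere. The index type may be infinite,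
  so coordinates outside \<open>I\<close> are pinned to 0; the box is then a product of compact
  sets.\<close>

lemma nonneg_rayleigh_maximizer:
  assumes "finite I" "I \<noteq> {}" and nonneg: "\<And>i j. i \<in> I \<Longrightarrow> j \<in> I \<Longrightarrow> 0 \<le> D i j"
  obtains x where "\<And>i. i \<in> I \<Longrightarrow> 0 \<le> x i" "(\<Sum>i\<in>I. (x i)\<^sup>2) = 1"
    "\<And>y. qform I D y \<le> qform I D x * (\<Sum>i\<in>I. (y i)\<^sup>2)"
proof -
  define box where "box = PiE UNIV (\<lambda>i. if i \<in> I then {0..1::real} else {0})"
  define K where "K = box \<inter> {x. (\<Sum>i\<in>I. (x i)\<^sup>2) = 1}"
  have "compact box"
    unfolding box_def compactin_euclidean_iff[symmetric] euclidean_product_topology[symmetric]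
    by (subst compactin_PiE) auto
  moreover have "closed {x. (\<Sum>i\<in>I. (x i)\<^sup>2) = (1::real)}"
    by (intro closed_Collect_eq continuous_intros continuous_on_product_coordinates)
  ultimately have "compact K"
    unfolding K_def by (rule compact_Int_closed)
  moreover obtain k where k: "k \<in> I"
    using assms(2) by blast
  have "(\<lambda>i. if i = k then 1 else 0) \<in> K"
    using assms(1) k by (auto simp: K_def box_def if_distrib[of "\<lambda>x. x\<^sup>2"] cong: if_cong)
  then have "K \<noteq> {}"
    by blast
  moreover have "continuous_on K (qform I D)"
    unfolding qform_def matvec_def
    by (intro continuous_intros continuous_on_subset[OF continuous_on_product_coordinates]) auto
  ultimately obtain x where x: "x \<in> K" and max: "\<And>y. y \<in> K \<Longrightarrow> qform I D y \<le> qform I D x"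
    using continuous_attains_sup[of K "qform I D"] by blast
  have "qform I D y \<le> qform I D x * (\<Sum>i\<in>I. (y i)\<^sup>2)" for y
  proof (cases "\<forall>i\<in>I. y i = 0")
    case True
    then show ?thesis
      by (simp add: qform_def)
  next
    case False
    define s where "s = (\<Sum>i\<in>I. (y i)\<^sup>2)"
    have s: "s > 0"
      using False assms(1) by (auto simp: s_def intro!: sum_pos2)
    \<comment> \<open>An arbitrary \<open>y\<close> is compared with the maximizer through its
      normalized absolute value, which lies in \<open>K\<close>.\<close>
    define z where "z = (\<lambda>i. if i \<in> I then (1 / sqrt s) * \<bar>y i\<bar> else 0)"
    have z0: "z i = 0" if "i \<notin> I" for i
      using that by (simp add: z_def)
    have sum_z: "(\<Sum>i\<in>I. (z i)\<^sup>2) = 1"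
    proof -
      have "(\<Sum>i\<in>I. (z i)\<^sup>2) = (\<Sum>i\<in>I. (y i)\<^sup>2 / s)"
        by (rule sum.cong) (use s in \<open>auto simp: z_def power_divide\<close>)
      also have "\<dots> = 1"
        using s by (simp add: sum_divide_distrib[symmetric] s_def[symmetric])
      finally show ?thesis .
    qed
    have "z i \<le> 1" if "i \<in> I" for i
    proof -
      have "(z i)\<^sup>2 \<le> 1"
        using member_le_sum[of i I "\<lambda>i. (z i)\<^sup>2"] that assms(1) sum_z by simp
      then show ?thesis
        by (simp add: abs_square_le_1)
    qed
    moreover have "0 \<le> z i" for i
      using s by (simp add: z_def)
    ultimately have "z \<in> K"
      using sum_z z0 by (auto simp: K_def box_def)
    then have "qform I D z \<le> qform I D x"
      by (rule max)
    moreover have "qform I D z = (1 / sqrt s)\<^sup>2 * qform I D (\<lambda>i. \<bar>y i\<bar>)"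
      unfolding qform_scale[symmetric] unfolding qform_def matvec_def z_def
      by (intro sum.cong refl) simp
    ultimately have "qform I D (\<lambda>i. \<bar>y i\<bar>) \<le> qform I D x * s"
      using s by (simp add: power_divide field_simps)
    then show ?thesis
      using qform_abs_le[of I D y, OF nonneg] by (simp add: s_def)
  qed
  then show ?thesis
    using that[of x] x by (fastforce simp: K_def box_def PiE_iff split: if_splits)
qed

locale positive_symmetric =
  fixes I :: "'i set" and D :: "'i \<Rightarrow> 'i \<Rightarrow> real"
  assumes finite: "finite I" and two: "2 \<le> card I"
    and symmetric: "\<And>i j. i \<in> I \<Longrightarrow> j \<in> I \<Longrightarrow> D i j = D j i"
    and diag: "\<And>i. i \<in> I \<Longrightarrow> 0 \<le> D i i"
    and off_diag: "\<And>i j. i \<in> I \<Longrightarrow> j \<in> I \<Longrightarrow> i \<noteq> j \<Longrightarrow> 0 < D i j"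
begin

lemma nonneg: "i \<in> I \<Longrightarrow> j \<in> I \<Longrightarrow> 0 \<le> D i j"
  using diag off_diag by (metis less_imp_le)

text \<open>A nonnegative Rayleigh maximizer is an eigenvector. One positive coordinate makes every
  other entry of its image positive, because the off-diagonal entries are positive; this spreads
  positivity to all coordinates.\<close>

lemma perron_vector:
  obtains x r where "\<And>i. i \<in> I \<Longrightarrow> 0 < x i" "0 < r" "\<And>i. i \<in> I \<Longrightarrow> matvec I D x i = r * x i"
    "\<And>y. qform I D y \<le> r * (\<Sum>i\<in>I. (y i)\<^sup>2)"
proof -
  have "I \<noteq> {}"
    using two by auto
  then obtain x where x: "\<And>i. i \<in> I \<Longrightarrow> 0 \<le> x i" "(\<Sum>i\<in>I. (x i)\<^sup>2) = 1"
    and max: "\<And>y. qform I D y \<le> qform I D x * (\<Sum>i\<in>I. (y i)\<^sup>2)"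
    using nonneg_rayleigh_maximizer[of I D, OF finite _ nonneg] by blast
  define r where "r = qform I D x"
  have ev: "matvec I D x i = r * x i" if "i \<in> I" for i
  proof (rule rayleigh_maximizer_eigenvector[OF finite _ _ _ that])
    show "D i j = D j i" if "i \<in> I" "j \<in> I" for i j
      using that by (rule symmetric)
    show "qform I D y \<le> r * (\<Sum>i\<in>I. (y i)\<^sup>2)" for y
      unfolding r_def by (rule max)
    show "qform I D x = r * (\<Sum>i\<in>I. (x i)\<^sup>2)"
      using x(2) by (simp add: r_def)
  qed
  obtain k where k: "k \<in> I" "x k \<noteq> 0"
  proof -
    have "\<exists>k\<in>I. x k \<noteq> 0"
    proof (rule ccontr)
      assume "\<not> (\<exists>k\<in>I. x k \<noteq> 0)"
      then show False
        using x(2) by simp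
    qed
    then show ?thesis
      using that by blast
  qed
  then have xk: "0 < x k"
    using x(1) by (simp add: less_le)
  have pos: "0 < r * x i" if "i \<in> I" "i \<noteq> k" for i
  proof -
    have "0 < matvec I D x i"
      unfolding matvec_def
      by (rule sum_pos2[OF finite k(1)])
        (use that k xk off_diag[of i k] nonneg x(1) in auto)
    then show ?thesis
      using ev that by simp
  qed
  \<comment> \<open>A second index is needed for \<open>0 < r\<close>: the diagonal entry at
    \<open>k\<close> may be 0.\<close>
  obtain l where "l \<in> I" "l \<noteq> k"
    using two by (metis card_le_Suc0_iff_eq finite not_less_eq_eq numeral_2_eq_2)
  then have "0 < r"
    using pos[of l] x(1)[of l] by (simp add: zero_less_mult_iff)
  moreover have "0 < x i" if "i \<in> I" for i
    using pos[OF that] x(1)[OF that] k \<open>0 < r\<close> by (cases "i = k") (auto simp: zero_less_mult_iff)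
  ultimately show ?thesis
    using that[of x r] ev max by (simp add: r_def)
qed

end

text \<open>Carries eigenvectors along \<open>\<phi>\<close> between the index set \<open>I\<close>
  and the vertex numbers that index \<open>distance_matrix\<close>.\<close>

lemma eigenvalue_distance_matrix_iff:
  assumes bij: "bij_betw \<phi> I {..<card (pverts H)}"
    and D: "\<And>i j. i \<in> I \<Longrightarrow> j \<in> I \<Longrightarrow> D i j = graph_dist H (\<phi> i) (\<phi> j)"
  shows "eigenvalue (distance_matrix H) r \<longleftrightarrow>
    (\<exists>y. (\<exists>i\<in>I. y i \<noteq> 0) \<and> (\<forall>i\<in>I. matvec I D y i = r * y i))"
proof -
  let ?N = "card (pverts H)"
  have im: "\<phi> i < ?N" if "i \<in> I" for i
    using bij that by (auto simp: bij_betw_def)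
  have mv: "(distance_matrix H *\<^sub>v vec ?N f) $ (\<phi> i) = matvec I D (f \<circ> \<phi>) i" if "i \<in> I" for f i
  proof -
    have "(distance_matrix H *\<^sub>v vec ?N f) $ (\<phi> i) = (\<Sum>j<?N. graph_dist H (\<phi> i) j * f j)"
      using im[OF that] by (simp add: distance_matrix_def scalar_prod_def lessThan_atLeast0)
    also have "\<dots> = matvec I D (f \<circ> \<phi>) i"
      unfolding matvec_def sum.reindex_bij_betw[OF bij, symmetric]
      by (rule sum.cong) (use D that in auto)
    finally show ?thesis .
  qed
  show ?thesis
  proof
    assume "eigenvalue (distance_matrix H) r"
    then obtain w where w: "w \<in> carrier_vec ?N" "w \<noteq> 0\<^sub>v ?N" "distance_matrix H *\<^sub>v w = r \<cdot>\<^sub>v w"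
      by (auto simp: eigenvalue_def eigenvector_def distance_matrix_def)
    have w': "w = vec ?N (\<lambda>i. w $ i)"
      using w(1) by auto
    obtain k where k: "k < ?N" "w $ k \<noteq> 0"
      using w(1,2) by (metis carrier_vecD eq_vecI index_zero_vec)
    then obtain i where "i \<in> I" "\<phi> i = k"
      using bij by (metis bij_betw_def imageE lessThan_iff)
    moreover have "matvec I D ((\<lambda>i. w $ i) \<circ> \<phi>) i = r * ((\<lambda>i. w $ i) \<circ> \<phi>) i" if "i \<in> I" for i
      using mv[OF that, of "\<lambda>i. w $ i"] w(1,3) im[OF that] unfolding w'[symmetric] by simp
    ultimately show "\<exists>y. (\<exists>i\<in>I. y i \<noteq> 0) \<and> (\<forall>i\<in>I. matvec I D y i = r * y i)"
      using k by (intro exI[of _ "(\<lambda>i. w $ i) \<circ> \<phi>"]) auto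
  next
    assume "\<exists>y. (\<exists>i\<in>I. y i \<noteq> 0) \<and> (\<forall>i\<in>I. matvec I D y i = r * y i)"
    then obtain y k where y: "k \<in> I" "y k \<noteq> 0" "\<And>i. i \<in> I \<Longrightarrow> matvec I D y i = r * y i"
      by blast
    define f where "f = y \<circ> inv_into I \<phi>"
    have f: "f (\<phi> i) = y i" if "i \<in> I" for i
      using bij that by (simp add: f_def bij_betw_def)
    have "matvec I D (f \<circ> \<phi>) i = matvec I D y i" for i
      unfolding matvec_def by (rule sum.cong) (simp_all add: f)
    then have mv': "(distance_matrix H *\<^sub>v vec ?N f) $ (\<phi> i) = r * f (\<phi> i)" if "i \<in> I" for i
      using mv y(3) f that by simp
    have "distance_matrix H *\<^sub>v vec ?N f = r \<cdot>\<^sub>v vec ?N f"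
    proof
      fix j assume "j < dim_vec (r \<cdot>\<^sub>v vec ?N f)"
      then have j: "j < ?N" by simp
      then obtain i where "i \<in> I" "j = \<phi> i"
        using bij by (metis bij_betw_def imageE lessThan_iff)
      then show "(distance_matrix H *\<^sub>v vec ?N f) $ j = (r \<cdot>\<^sub>v vec ?N f) $ j"
        using mv' j by simp
    qed (simp add: distance_matrix_def)
    moreover have "vec ?N f \<noteq> 0\<^sub>v ?N"
      using im[OF y(1)] f[OF y(1)] y(2) by (metis index_vec index_zero_vec(1))
    ultimately show "eigenvalue (distance_matrix H) r"
      unfolding eigenvalue_def eigenvector_def
      by (intro exI[of _ "vec ?N f"]) (simp add: distance_matrix_def)
  qed
qed

context positive_symmetric
begin

text \<open>The Perron value is an eigenvalue and, by the bound on \<open>qform\<close> at absolute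
  values, dominates every eigenvalue in magnitude; hence it is what \<open>Max\<close>
  selects.\<close>

lemma distance_spectral_radius_perron:
  assumes bij: "bij_betw \<phi> I {..<card (pverts H)}"
    and D: "\<And>i j. i \<in> I \<Longrightarrow> j \<in> I \<Longrightarrow> D i j = graph_dist H (\<phi> i) (\<phi> j)"
  obtains x where "\<And>i. i \<in> I \<Longrightarrow> 0 < x i" "0 < distance_spectral_radius H"
    "\<And>i. i \<in> I \<Longrightarrow> matvec I D x i = distance_spectral_radius H * x i"
    "\<And>y. qform I D y \<le> distance_spectral_radius H * (\<Sum>i\<in>I. (y i)\<^sup>2)"
proof -
  obtain x r where x: "\<And>i. i \<in> I \<Longrightarrow> 0 < x i" "0 < r"
    "\<And>i. i \<in> I \<Longrightarrow> matvec I D x i = r * x i"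
    "\<And>y. qform I D y \<le> r * (\<Sum>i\<in>I. (y i)\<^sup>2)"
    using perron_vector by blast
  have eigenvalue_iff: "eigenvalue (distance_matrix H) s \<longleftrightarrow>
      (\<exists>y. (\<exists>i\<in>I. y i \<noteq> 0) \<and> (\<forall>i\<in>I. matvec I D y i = s * y i))" for s
    by (rule eigenvalue_distance_matrix_iff[OF bij]) (rule D)
  let ?S = "spectrum (distance_matrix H)"
  obtain k where "k \<in> I"
    using two by fastforce
  then have r: "r \<in> ?S"
    unfolding spectrum_def mem_Collect_eq eigenvalue_iff
    using x(1,3) by (metis less_irrefl)
  have le: "\<bar>s\<bar> \<le> r" if s: "s \<in> ?S" for s
  proof -
    obtain y i where i: "i \<in> I" "y i \<noteq> 0" and y: "\<And>i. i \<in> I \<Longrightarrow> matvec I D y i = s * y i"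
      using s unfolding spectrum_def mem_Collect_eq eigenvalue_iff by blast
    have pos: "0 < (\<Sum>i\<in>I. (y i)\<^sup>2)"
      by (rule sum_pos2[OF finite i(1)]) (use i in auto)
    have "\<bar>s\<bar> * (\<Sum>i\<in>I. (y i)\<^sup>2) = \<bar>qform I D y\<bar>"
      using qform_eq_scale[OF y] pos by (simp add: abs_mult)
    also have "\<dots> \<le> qform I D (\<lambda>i. \<bar>y i\<bar>)"
      by (rule qform_abs_le[of I D, OF nonneg])
    also have "\<dots> \<le> r * (\<Sum>i\<in>I. (y i)\<^sup>2)"
      using x(4)[of "\<lambda>i. \<bar>y i\<bar>"] by simp
    finally show ?thesis
      using pos by simp
  qed
  have "distance_spectral_radius H = r"
    unfolding distance_spectral_radius_def
  proof (rule Max_eqI)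
    have "distance_matrix H \<in> carrier_mat (card (pverts H)) (card (pverts H))"
      by (simp add: distance_matrix_def)
    then show "Finite_Set.finite {s \<in> ?S. \<forall>t\<in>?S. \<bar>t\<bar> \<le> \<bar>s\<bar>}"
      using card_finite_spectrum(1) by (metis (no_types, lifting) finite_subset mem_Collect_eq subsetI)
  qed (use le r \<open>0 < r\<close> in force)+
  then show ?thesis
    using that x by blast
qed

end

text \<open>Without a strict increase, \<open>x\<close> would attain the Rayleigh maximum of
  \<open>D'\<close> and thus be an eigenvector of \<open>D'\<close> for the same value, which row
  \<open>k\<close> refutes.\<close>

lemma distance_spectral_radius_less:
  assumes D: "positive_symmetric I D" and D': "positive_symmetric I D'"
    and bij': "bij_betw \<psi> I {..<card (pverts H')}"
    and dist': "\<And>i j. i \<in> I \<Longrightarrow> j \<in> I \<Longrightarrow> D' i j = graph_dist H' (\<psi> i) (\<psi> j)"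
    and pos: "\<And>i. i \<in> I \<Longrightarrow> 0 < x i"
    and ev: "\<And>i. i \<in> I \<Longrightarrow> matvec I D x i = distance_spectral_radius H * x i"
    and le: "qform I D x \<le> qform I D' x"
    and neq: "k \<in> I" "matvec I D x k \<noteq> matvec I D' x k"
  shows "distance_spectral_radius H < distance_spectral_radius H'"
proof (rule ccontr)
  interpret D: positive_symmetric I D by (rule D)
  interpret D': positive_symmetric I D' by (rule D')
  let ?r = "distance_spectral_radius H" and ?r' = "distance_spectral_radius H'"
  let ?S = "\<Sum>i\<in>I. (x i)\<^sup>2"
  assume "\<not> ?r < ?r'"
  have max: "qform I D' y \<le> ?r' * (\<Sum>i\<in>I. (y i)\<^sup>2)" for y
    using D'.distance_spectral_radius_perron[OF bij' dist'] by blast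
  have S: "0 < ?S"
    by (rule sum_pos2[OF D.finite neq(1)]) (use pos neq(1) in \<open>auto simp: less_le\<close>)
  have "?r * ?S = qform I D x"
    by (rule qform_eq_scale[OF ev, symmetric])
  then have "?r * ?S \<le> qform I D' x" "qform I D' x \<le> ?r' * ?S"
    using le max[of x] by simp_all
  moreover have "?r' * ?S \<le> ?r * ?S"
    using S \<open>\<not> ?r < ?r'\<close> by (intro mult_right_mono) auto
  ultimately have "?r' * ?S = ?r * ?S" and eq: "qform I D' x = ?r' * ?S"
    by linarith+
  then have "?r' = ?r"
    using S by simp
  moreover have "matvec I D' x k = ?r' * x k"
    by (rule rayleigh_maximizer_eigenvector[OF D.finite D'.symmetric max eq neq(1)])
  ultimately show False
    using ev[OF neq(1)] neq(2) by simp
qed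

section \<open>Graph metrics\<close>

text \<open>The assumptions determine \<open>d\<close>: \<open>step\<close> makes it a lower bound for walk lengths and \<open>pred\<close>
  provides walks attaining it.\<close>
locale graph_metric = pair_wf_digraph H for H :: "'a pair_pre_digraph" +
  fixes d :: "'a \<Rightarrow> 'a \<Rightarrow> nat"
  assumes refl: "x \<in> pverts H \<Longrightarrow> d x x = 0"
    and sym: "x \<in> pverts H \<Longrightarrow> y \<in> pverts H \<Longrightarrow> d x y = d y x"
    and step: "x \<in> pverts H \<Longrightarrow> (y, z) \<in> parcs H \<Longrightarrow> d x z \<le> d x y + 1"
    and pred: "x \<in> pverts H \<Longrightarrow> z \<in> pverts H \<Longrightarrow> x \<noteq> z \<Longrightarrow>
      \<exists>y. (y, z) \<in> parcs H \<and> d x z = d x y + 1"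
begin

lemma pos: "x \<in> pverts H \<Longrightarrow> z \<in> pverts H \<Longrightarrow> x \<noteq> z \<Longrightarrow> 0 < d x z"
  using pred by fastforce

text \<open>The separate base point \<open>w\<close> stays fixed while the induction peels off first
  arcs and moves the start \<open>x\<close>.\<close>

lemma awalk_length_ge:
  assumes "w \<in> pverts H" "awalk x p z"
  shows "d w z \<le> d w x + length p"
  using assms(2)
proof (induction p arbitrary: x)
  case (Cons e p)
  then show ?case
    using step[OF assms(1), of "fst e" "snd e"] arc_snd_in_verts[of e]
    by (force simp: awalk_def)
qed (simp add: awalk_def)

lemma shortest_awalk:
  assumes "x \<in> pverts H" "z \<in> pverts H"
  shows "\<exists>p. awalk x p z \<and> length p = d x z"
  using assms(2)
proof (induction "d x z" arbitrary: z)
  case 0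
  then have "x = z"
    using pos[OF assms(1)] by fastforce
  then show ?case
    using assms(1) refl by (intro exI[of _ "[]"]) (simp add: awalk_def)
next
  case (Suc l)
  then have "x \<noteq> z"
    using refl by fastforce
  then obtain y where y: "(y, z) \<in> parcs H" "d x z = d x y + 1"
    using pred[OF assms(1) Suc.prems] by blast
  then have "y \<in> pverts H"
    using in_arcsD1 by blast
  then obtain p where "awalk x p y" "length p = d x y"
    using Suc.hyps y(2) by fastforce
  moreover have "awalk y [(y, z)] z"
    using y(1) \<open>y \<in> pverts H\<close> by (simp add: awalk_def)
  ultimately show ?case
    using y(2) by (intro exI[of _ "p @ [(y, z)]"]) (auto intro: awalk_appendI)
qed

lemma \<mu>_eq:
  assumes "x \<in> pverts H" "z \<in> pverts H"
  shows "\<mu> (\<lambda>_. 1) x z = ereal (real (d x z))"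
proof (rule antisym)
  have cost: "awalk_cost (\<lambda>_. 1) p = real (length p)" for p :: "('a \<times> 'a) list"
    by (induction p) auto
  obtain p where p: "awalk x p z" "length p = d x z"
    using shortest_awalk[OF assms] by blast
  show "\<mu> (\<lambda>_. 1) x z \<le> ereal (real (d x z))"
    using min_cost_le_walk_cost[OF p(1), of "\<lambda>_. 1"] p(2) by (simp add: cost)
  show "ereal (real (d x z)) \<le> \<mu> (\<lambda>_. 1) x z"
    unfolding \<mu>_def using awalk_length_ge[OF assms(1)] refl[OF assms(1)]
    by (intro INF_greatest) (fastforce simp: cost)
qed

end

lemma graph_metric_graph_dist:
  assumes "graph_metric H d" "x \<in> pverts H" "z \<in> pverts H"
  shows "graph_dist H x z = real (d x z)"
  using graph_metric.\<mu>_eq[OF assms] by (simp add: graph_dist_def)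

lemma connected_graph_metric:
  assumes "pair_graph G" "Digraph_Component.connected (with_proj G)"
  obtains d where "graph_metric G d"
proof -
  interpret G: pair_graph G by (rule assms(1))
  let ?R = "parcs G"
  \<comment> \<open>Distance as the least exponent of a power of the arc relation; connectedness
    (\<open>ex\<close>) ensures that it is attained.\<close>
  define d where "d = (\<lambda>x y. LEAST n. (x, y) \<in> ?R ^^ n)"
  have "sym ?R"
    using G.sym_arcs by (simp add: symmetric_def)
  then have conv: "(y, x) \<in> ?R ^^ n" if "(x, y) \<in> ?R ^^ n" for x y n
    using that
  proof (induction n arbitrary: y)
    case (Suc n)
    then obtain w where "(x, w) \<in> ?R ^^ n" "(w, y) \<in> ?R"
      by auto
    then show ?case
      using Suc.IH \<open>sym ?R\<close> relpow_Suc_I2[of y w ?R x n] by (blast dest: symD)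
  qed simp
  \<comment> \<open>\<open>connected\<close> speaks of the symmetric closure, which adds no arcs
    here.\<close>
  have mk: "parcs (mk_symmetric (with_proj G)) = ?R"
    using \<open>sym ?R\<close> by (auto simp: mk_symmetric_def sym_def)
  have ex: "(x, y) \<in> ?R ^^ d x y" if "x \<in> pverts G" "y \<in> pverts G" for x y
  proof -
    have "x \<rightarrow>\<^sup>*\<^bsub>mk_symmetric (with_proj G)\<^esub> y"
      using assms(2) that by (auto simp: connected_def strongly_connected_def)
    then have "(x, y) \<in> ?R\<^sup>*"
      unfolding reachable_def with_proj_simps mk by (rule rtrancl_on_rtranclI)
    then show ?thesis
      unfolding d_def rtrancl_power by (rule LeastI_ex)
  qed
  have least: "d x y \<le> n" if "(x, y) \<in> ?R ^^ n" for x y n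
    unfolding d_def using that by (rule Least_le)
  have "graph_metric G d"
  proof
    fix x assume x: "x \<in> pverts G"
    show "d x x = 0"
      using least[of x x 0] by simp
    show "d x y = d y x" if "y \<in> pverts G" for y
      using least[OF conv[OF ex[OF x that]]] least[OF conv[OF ex[OF that x]]] by simp
    show "d x z \<le> d x y + 1" if "(y, z) \<in> ?R" for y z
      using least[OF relpow_Suc_I[OF ex[OF x] that]] that G.in_arcsD1 by simp
    show "\<exists>y. (y, z) \<in> ?R \<and> d x z = d x y + 1" if z: "z \<in> pverts G" "x \<noteq> z" for z
    proof -
      obtain n where n: "d x z = Suc n"
        using ex[OF x z(1)] z(2) by (cases "d x z") auto
      then obtain y where y: "(x, y) \<in> ?R ^^ n" "(y, z) \<in> ?R"
        using ex[OF x z(1)] by auto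
      have "d x z \<le> Suc (d x y)"
        using least[OF relpow_Suc_I[OF ex[OF x] y(2)]] y(2) G.in_arcsD1 by simp
      then show ?thesis
        using least[OF y(1)] n y(2) by force
    qed
  qed
  then show ?thesis
    by (rule that)
qed

section \<open>The metric of a graph with an added path\<close>

text \<open>The metric of \<open>add_path H u k\<close> when \<open>H\<close> has vertex set \<open>{0..<n}\<close> and metric \<open>d\<close>; the truncated
  difference \<open>Suc x - n\<close> is the distance of \<open>x\<close> from the old vertices.\<close>
definition ext_dist :: "nat \<Rightarrow> nat \<Rightarrow> (nat \<Rightarrow> nat \<Rightarrow> nat) \<Rightarrow> nat \<Rightarrow> nat \<Rightarrow> nat" where
  "ext_dist n u d x y =
    (if n \<le> x \<and> n \<le> y then (x - y) + (y - x)
     else d (if x < n then x else u) (if y < n then y else u) + (Suc x - n) + (Suc y - n))"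

lemma pverts_add_path:
  assumes "pverts H = {0..<n}"
  shows "pverts (add_path H u k) = {0..<n + k}"
  unfolding add_path_def Let_def assms
  by (simp only: pair_pre_digraph.simps card_atLeastLessThan diff_zero ivl_disj_un_two(3) le0 le_add1)

lemma parcs_add_path:
  assumes "pverts H = {0..<n}"
  shows "parcs (add_path H u k) = parcs H \<union>
    (\<Union>i<k. {(path_vertex n u i, path_vertex n u (Suc i)), (path_vertex n u (Suc i), path_vertex n u i)})"
  unfolding add_path_def Let_def assms
  by (simp only: pair_pre_digraph.simps card_atLeastLessThan diff_zero)

lemma graph_metric_add_path:
  assumes "graph_metric H d" and V: "pverts H = {0..<n}" and u: "u < n"
  shows "graph_metric (add_path H u k) (ext_dist n u d)"
proof -
  interpret H: graph_metric H d by (rule assms(1))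
  note arcs = parcs_add_path[OF V] and verts = pverts_add_path[OF V]
  have old: "x < n" "y < n" if "(x, y) \<in> parcs H" for x y
    using that H.in_arcsD1 H.in_arcsD2 V by auto
  show ?thesis
  proof
    fix e assume "e \<in> parcs (add_path H u k)"
    then consider "(fst e, snd e) \<in> parcs H"
      | i where "i < k" "{fst e, snd e} = {path_vertex n u i, path_vertex n u (Suc i)}"
      unfolding arcs by fastforce
    then have "fst e < n + k \<and> snd e < n + k"
    proof cases
      case 1
      then show ?thesis
        using old[of "fst e" "snd e"] by simp
    next
      case 2
      moreover have "path_vertex n u i < n + k" "path_vertex n u (Suc i) < n + k"
        using 2(1) u by (auto simp: path_vertex_def)
      ultimately show ?thesis
        by (metis doubleton_eq_iff)
    qed
    then show "fst e \<in> pverts (add_path H u k)" "snd e \<in> pverts (add_path H u k)"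
      by (simp_all add: verts)
  next
    fix x assume "x \<in> pverts (add_path H u k)"
    then have x: "x < n + k"
      by (simp add: verts)
    show "ext_dist n u d x x = 0"
      using H.refl V by (auto simp: ext_dist_def)
    show "ext_dist n u d x y = ext_dist n u d y x" for y
      using H.sym V u by (auto simp: ext_dist_def)
    show "ext_dist n u d x z \<le> ext_dist n u d x y + 1"
      if arc: "(y, z) \<in> parcs (add_path H u k)" for y z
    proof -
      consider "(y, z) \<in> parcs H"
        | i where "i < k" "y = path_vertex n u i" "z = path_vertex n u (Suc i)"
        | i where "i < k" "y = path_vertex n u (Suc i)" "z = path_vertex n u i"
        using arc unfolding arcs by blast
      then show ?thesis
      proof cases
        case 1
        then show ?thesis
          using H.step[OF _ 1, of "if x < n then x else u"] old[OF 1] V u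
          by (simp add: ext_dist_def)
      next
        case 2
        then show ?thesis
          using H.refl[of u] V u by (cases i) (auto simp: ext_dist_def path_vertex_def)
      next
        case 3
        then show ?thesis
          using H.refl[of u] V u by (cases i) (auto simp: ext_dist_def path_vertex_def)
      qed
    qed
    fix z assume "z \<in> pverts (add_path H u k)" and xz: "x \<noteq> z"
    then have z: "z < n + k"
      by (simp add: verts)
    have new_arc: "(path_vertex n u i, path_vertex n u (Suc i)) \<in> parcs (add_path H u k)"
      "(path_vertex n u (Suc i), path_vertex n u i) \<in> parcs (add_path H u k)" if "i < k" for i
      using that by (auto simp: arcs)
    \<comment> \<open>Each case names the last vertex before \<open>z\<close> on a shortest path
      from \<open>x\<close>. A new vertex \<open>z\<close> has path index \<open>z - n + 1\<close>,
      so its neighbour towards \<open>u\<close> has index \<open>z - n\<close>, and index 0 is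
      \<open>u\<close> itself.\<close>
    consider "x < n" "z < n" | "n \<le> x" "z = u" | "n \<le> x" "z < n" "z \<noteq> u" | "x < n" "n \<le> z"
      | "n \<le> x" "x < z" | "n \<le> z" "z < x"
      using xz by linarith
    then show "\<exists>y. (y, z) \<in> parcs (add_path H u k) \<and> ext_dist n u d x z = ext_dist n u d x y + 1"
    proof cases
      case 1
      then show ?thesis
        using H.pred[of x z] xz V old by (force simp: arcs ext_dist_def)
    next
      case 2
      then show ?thesis
        using new_arc(2)[of 0] x u H.refl[of u] V
        by (intro exI[of _ n]) (auto simp: path_vertex_def ext_dist_def)
    next
      case 3
      then show ?thesis
        using H.pred[of u z] u V old by (force simp: arcs ext_dist_def)
    next
      case 4
      then show ?thesis
        using new_arc(1)[of "z - n"] z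
        by (intro exI[of _ "path_vertex n u (z - n)"]) (auto simp: path_vertex_def ext_dist_def u)
    next
      case 5
      then show ?thesis
        using new_arc(1)[of "z - n"] z
        by (intro exI[of _ "path_vertex n u (z - n)"]) (auto simp: path_vertex_def ext_dist_def u)
    next
      case 6
      then show ?thesis
        using new_arc(2)[of "Suc z - n"] x
        by (intro exI[of _ "Suc z"]) (auto simp: path_vertex_def ext_dist_def Suc_diff_le)
    qed
  qed
qed

section \<open>Moving the rest of the graph along the path\<close>

text \<open>With \<open>t i\<close> the total weight of the positions below \<open>a - i\<close> minus that of the positions above
  \<open>a + i\<close>, the differences \<open>y i = t i - t (i + 1)\<close> satisfy \<open>r * y 0 = c - 2 * t 0\<close> and
  \<open>r * (y (i + 1) - y i) = - 2 * t (i + 1)\<close>. So \<open>t 0 < 0\<close> would propagate to all \<open>t i\<close>, up to the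
  end of the right part, where \<open>t i\<close> is a sum of nonnegative weights.\<close>
lemma path_balance:
  fixes x :: "nat \<Rightarrow> real" and r c :: real
  assumes "0 < r" "0 \<le> c" "a < m" "m \<le> 2 * a + 1" and nonneg: "\<And>s. s < m \<Longrightarrow> 0 \<le> x s"
    and ev: "\<And>i. a + 1 + i < m \<Longrightarrow> r * (x (a - 1 - i) - x (a + 1 + i)) =
      c + (\<Sum>s<m. (\<bar>real (a - 1 - i) - real s\<bar> - \<bar>real (a + 1 + i) - real s\<bar>) * x s)"
  shows "0 \<le> (\<Sum>s<m. (if s < a then 1 else if a < s then - 1 else 0) * x s)"
proof (rule ccontr)
  define w where "w = (\<lambda>i s. if s + i < a then 1 else if a + i < s then - 1 else 0 :: real)"
  define t where "t = (\<lambda>i. \<Sum>s<m. w i s * x s)"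
  define y where "y = (\<lambda>i. x (a - 1 - i) - x (a + 1 + i))"
  assume "\<not> ?thesis"
  then have t0: "t 0 < 0"
    unfolding t_def w_def by (simp only: add_0_right not_le)
  \<comment> \<open>The distances to \<open>a - 1\<close> and \<open>a + 1\<close> differ by -2 from
    positions below \<open>a\<close>, by 0 from \<open>a\<close> and by 2 from positions above. The
    bound \<open>m \<le> 2 * a + 1\<close> keeps \<open>a - 1 - i\<close> from being
    truncated.\<close>
  have y0: "r * y 0 = c - 2 * t 0" if "a + 1 < m"
  proof -
    have "(\<Sum>s<m. (\<bar>real (a - 1 - 0) - real s\<bar> - \<bar>real (a + 1 + 0) - real s\<bar>) * x s) = (\<Sum>s<m. - 2 * (w 0 s * x s))"
      by (rule sum.cong) (use that assms(4) in \<open>auto simp: w_def of_nat_diff\<close>)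
    then show ?thesis
      using ev[of 0] that unfolding y_def t_def sum_distrib_left by (simp add: sum_negf)
  qed
  have y_Suc: "r * y (Suc i) = r * y i - 2 * t (Suc i)" if "a + 2 + i < m" for i
  proof -
    let ?f = "\<lambda>i s. (\<bar>real (a - 1 - i) - real s\<bar> - \<bar>real (a + 1 + i) - real s\<bar>) * x s"
    have "(\<Sum>s<m. ?f (Suc i) s) - (\<Sum>s<m. ?f i s) = (\<Sum>s<m. - 2 * (w (Suc i) s * x s))"
      unfolding sum_subtractf[symmetric] left_diff_distrib[symmetric] mult.assoc[symmetric]
    proof (rule sum.cong)
      fix s assume "s \<in> {..<m}"
      then show "(\<bar>real (a - 1 - Suc i) - real s\<bar> - \<bar>real (a + 1 + Suc i) - real s\<bar> -
          (\<bar>real (a - 1 - i) - real s\<bar> - \<bar>real (a + 1 + i) - real s\<bar>)) * x s = - 2 * w (Suc i) s * x s"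
        using that assms(4) by (auto simp: w_def of_nat_diff)
    qed simp
    then have "r * y (Suc i) - r * y i = (\<Sum>s<m. - 2 * (w (Suc i) s * x s))"
      using ev[of i] ev[of "Suc i"] that unfolding y_def by simp
    then show ?thesis
      unfolding t_def sum_distrib_left by (simp add: sum_negf)
  qed
  have t_Suc: "t (Suc i) = t i - y i" if "a + 1 + i < m" for i
  proof -
    have "t i - t (Suc i) = (\<Sum>s<m. (if s = a - 1 - i then x s else 0) - (if s = a + 1 + i then x s else 0))"
      unfolding t_def sum_subtractf[symmetric]
      by (rule sum.cong) (use that assms(4) in \<open>auto simp: w_def\<close>)
    also have "\<dots> = y i"
      unfolding sum_subtractf y_def using that assms(3) by (simp add: sum.delta)
    finally show ?thesis
      by simp
  qed
  \<comment> \<open>The recurrence has order two, so the induction also carries the sign of the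
    preceding difference.\<close>
  have "t i < 0 \<and> (0 < i \<longrightarrow> 0 < y (i - 1))" if "a + i < m" for i
    using that
  proof (induction i)
    case 0
    then show ?case
      using t0 by simp
  next
    case (Suc i)
    then have IH: "t i < 0" "0 < i \<longrightarrow> 0 < y (i - 1)"
      by simp_all
    have "0 < r * y i"
    proof (cases i)
      case 0
      then show ?thesis
        using y0 Suc.prems t0 assms(2) by simp
    next
      case (Suc j)
      then have "0 < r * y j"
        using IH assms(1) by simp
      then show ?thesis
        using y_Suc[of j] Suc \<open>a + Suc i < m\<close> IH(1) by simp
    qed
    then have "0 < y i"
      using assms(1) by (simp add: zero_less_mult_iff)
    then show ?case
      using t_Suc[of i] Suc.prems IH(1) by simp
  qed
  from this[of "m - 1 - a"] have "t (m - 1 - a) < 0"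
    using assms(3) by simp
  moreover have "0 \<le> t (m - 1 - a)"
    unfolding t_def by (rule sum_nonneg) (use nonneg assms(3) in \<open>auto simp: w_def\<close>)
  ultimately show False
    by simp
qed

text \<open>The two added paths and the edge \<open>uv\<close> form one path, whose vertices are numbered by their
  position (\<open>Inr\<close>) from the end of the path added at \<open>u\<close>; \<open>u\<close> has position \<open>a\<close> and \<open>v\<close> position
  \<open>a + 1\<close>. All other old vertices are \<open>Inl\<close>. Passing to the neighbouring graph then changes
  only \<open>a\<close>, hence only the distances between the two kinds.\<close>
definition leg :: "(nat \<Rightarrow> nat \<Rightarrow> nat) \<Rightarrow> nat \<Rightarrow> nat \<Rightarrow> nat \<Rightarrow> nat \<Rightarrow> nat \<Rightarrow> real" where
  "leg d u v a z s =
    (if s \<le> a then real (d z u) + (real a - real s) else real (d z v) + (real s - real a - 1))"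

lemma Plus_iff [simp]: "Inl a \<in> A <+> B \<longleftrightarrow> a \<in> A" "Inr b \<in> A <+> B \<longleftrightarrow> b \<in> B"
  by auto

fun layout :: "(nat \<Rightarrow> nat \<Rightarrow> nat) \<Rightarrow> nat \<Rightarrow> nat \<Rightarrow> nat \<Rightarrow> nat + nat \<Rightarrow> nat + nat \<Rightarrow> real" where
  "layout d u v a (Inl z) (Inl z') = real (d z z')"
| "layout d u v a (Inl z) (Inr s) = leg d u v a z s"
| "layout d u v a (Inr s) (Inl z) = leg d u v a z s"
| "layout d u v a (Inr s) (Inr t) = \<bar>real s - real t\<bar>"

lemma sum_Plus_lessThan:
  assumes "finite A"
  shows "(\<Sum>i\<in>A <+> {..<m}. f i) = (\<Sum>z\<in>A. f (Inl z)) + (\<Sum>s<m::nat. f (Inr s))"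
  using assms by (simp add: sum.Plus)

lemma matvec_layout_path:
  assumes "finite A"
  shows "matvec (A <+> {..<m}) (layout d u v a) x (Inr s) =
    (\<Sum>z\<in>A. leg d u v a z s * x (Inl z)) + (\<Sum>t<m. \<bar>real s - real t\<bar> * x (Inr t))"
  using assms by (simp add: matvec_def sum_Plus_lessThan)

text \<open>Only the two mutually transposed blocks between \<open>A\<close> and the path depend on
  the position of \<open>u\<close>; hence the factor 2.\<close>

lemma qform_layout_diff:
  assumes "finite A"
  shows "qform (A <+> {..<m}) (layout d u v b) x - qform (A <+> {..<m}) (layout d u v a) x =
    2 * (\<Sum>z\<in>A. x (Inl z) * (\<Sum>s<m. (leg d u v b z s - leg d u v a z s) * x (Inr s)))"
proof -
  have "qform (A <+> {..<m}) (layout d u v c) x =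
      (\<Sum>z\<in>A. x (Inl z) * (\<Sum>z'\<in>A. real (d z z') * x (Inl z')))
      + (\<Sum>s<m. x (Inr s) * (\<Sum>t<m. \<bar>real s - real t\<bar> * x (Inr t)))
      + 2 * (\<Sum>z\<in>A. x (Inl z) * (\<Sum>s<m. leg d u v c z s * x (Inr s)))" for c
  proof -
    have "(\<Sum>s<m. x (Inr s) * (\<Sum>z\<in>A. leg d u v c z s * x (Inl z)))
        = (\<Sum>s<m. \<Sum>z\<in>A. x (Inl z) * (leg d u v c z s * x (Inr s)))"
      by (simp add: sum_distrib_left algebra_simps)
    also have "\<dots> = (\<Sum>z\<in>A. \<Sum>s<m. x (Inl z) * (leg d u v c z s * x (Inr s)))"
      by (rule sum.swap)
    also have "\<dots> = (\<Sum>z\<in>A. x (Inl z) * (\<Sum>s<m. leg d u v c z s * x (Inr s)))"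
      by (simp add: sum_distrib_left)
    finally show ?thesis
      using assms by (simp add: qform_def matvec_def sum_Plus_lessThan distrib_left sum.distrib)
  qed
  then show ?thesis
    by (simp add: left_diff_distrib right_diff_distrib sum_subtractf)
qed

text \<open>\<open>\<sigma>\<close> bounds the change of distance from below uniformly in
  \<open>z\<close>, so that one balance condition on the path weights serves every vertex of
  \<open>A\<close>. Row \<open>t\<close> sees all its distances to \<open>A\<close> grow.\<close>

lemma layout_shift:
  assumes A: "finite A" "A \<noteq> {}"
    and pos: "\<And>i. i \<in> A <+> {..<m} \<Longrightarrow> 0 < x i"
    and ge: "\<And>z s. z \<in> A \<Longrightarrow> s < m \<Longrightarrow> \<sigma> s \<le> leg d u v b z s - leg d u v a z s"
    and balance: "0 \<le> (\<Sum>s<m. \<sigma> s * x (Inr s))"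
    and strict: "t < m" "\<And>z. z \<in> A \<Longrightarrow> leg d u v a z t < leg d u v b z t"
  shows "qform (A <+> {..<m}) (layout d u v a) x \<le> qform (A <+> {..<m}) (layout d u v b) x"
    and "matvec (A <+> {..<m}) (layout d u v a) x (Inr t) \<noteq> matvec (A <+> {..<m}) (layout d u v b) x (Inr t)"
proof -
  have posl: "0 < x (Inl z)" if "z \<in> A" for z
    using pos that by simp
  have posr: "0 < x (Inr s)" if "s < m" for s
    using pos that by simp
  have "0 \<le> (\<Sum>s<m. (leg d u v b z s - leg d u v a z s) * x (Inr s))" if "z \<in> A" for z
    using balance
  proof (rule order_trans)
    show "(\<Sum>s<m. \<sigma> s * x (Inr s)) \<le> (\<Sum>s<m. (leg d u v b z s - leg d u v a z s) * x (Inr s))"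
    proof (intro sum_mono mult_right_mono)
      fix s assume "s \<in> {..<m}"
      then show "\<sigma> s \<le> leg d u v b z s - leg d u v a z s" "0 \<le> x (Inr s)"
        using ge[OF that] posr[of s] by simp_all
    qed
  qed
  then have "0 \<le> x (Inl z) * (\<Sum>s<m. (leg d u v b z s - leg d u v a z s) * x (Inr s))" if "z \<in> A" for z
    using posl[OF that] that by simp
  then have "0 \<le> (\<Sum>z\<in>A. x (Inl z) * (\<Sum>s<m. (leg d u v b z s - leg d u v a z s) * x (Inr s)))"
    by (rule sum_nonneg)
  then show "qform (A <+> {..<m}) (layout d u v a) x \<le> qform (A <+> {..<m}) (layout d u v b) x"
    using qform_layout_diff[OF A(1), of m d u v b x a] by simp
  have "(\<Sum>z\<in>A. leg d u v a z t * x (Inl z)) < (\<Sum>z\<in>A. leg d u v b z t * x (Inl z))"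
    using A posl strict(2) by (intro sum_strict_mono mult_strict_right_mono) auto
  then show "matvec (A <+> {..<m}) (layout d u v a) x (Inr t) \<noteq> matvec (A <+> {..<m}) (layout d u v b) x (Inr t)"
    using A(1) by (simp add: matvec_layout_path)
qed

lemma ext_dist_old: "x < n \<Longrightarrow> y < n \<Longrightarrow> ext_dist n u d x y = d x y"
  by (simp add: ext_dist_def)

lemma ext_dist_path:
  assumes "u < n"
  shows "x < n \<Longrightarrow> ext_dist n u d x (path_vertex n u i) = d x u + i"
    and "x < n \<Longrightarrow> ext_dist n u d (path_vertex n u i) x = d u x + i"
    and "d u u = 0 \<Longrightarrow> ext_dist n u d (path_vertex n u i) (path_vertex n u j) = (i - j) + (j - i)"
  using assms by (auto simp: ext_dist_def path_vertex_def)

section \<open>The graphs with two added paths\<close>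

text \<open>The bound \<open>three\<close> leaves a vertex besides \<open>u\<close> and
  \<open>v\<close>; if \<open>G\<close> were a single edge, all graphs with the same
  \<open>k + l\<close> would be the same path.\<close>

locale rooted_edge = graph_metric G d for G :: "nat pair_pre_digraph" and d +
  fixes n u v :: nat
  assumes verts: "pverts G = {0..<n}" and edge: "(u, v) \<in> parcs G" "(v, u) \<in> parcs G"
    and ne: "u \<noteq> v" and three: "3 \<le> n"
begin

abbreviation A where "A \<equiv> {0..<n} - {u, v}"

lemma uv: "u < n" "v < n"
  using in_arcsD1[OF edge(1)] in_arcsD1[OF edge(2)] unfolding verts atLeastLessThan_iff by blast+

lemma card_A: "card A = n - 2"
proof -
  have "card A = card {0..<n} - card {u, v}"
    using uv by (intro card_Diff_subset) auto
  then show ?thesis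
    using ne by simp
qed

lemma A_ne: "A \<noteq> {}"
proof
  assume "A = {}"
  then have "card A = 0"
    by (simp only: card.empty)
  then show False
    using card_A three by linarith
qed

lemma d_refl: "x < n \<Longrightarrow> d x x = 0"
  by (rule refl) (simp only: verts atLeastLessThan_iff le0 simp_thms)

lemma d_commute: "x < n \<Longrightarrow> y < n \<Longrightarrow> d x y = d y x"
  by (rule sym) (simp_all only: verts atLeastLessThan_iff le0 simp_thms)

lemma d_pos: "x < n \<Longrightarrow> y < n \<Longrightarrow> x \<noteq> y \<Longrightarrow> 0 < d x y"
  by (rule pos) (simp_all only: verts atLeastLessThan_iff le0 simp_thms)

lemma d_u_v:
  assumes "z < n"
  shows "d z u \<le> d z v + 1" "d z v \<le> d z u + 1"
  by (rule step[OF _ edge(2)] step[OF _ edge(1)],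
      use assms in \<open>simp only: verts atLeastLessThan_iff le0 simp_thms\<close>)+

lemma d_uv: "d u v = 1"
  using d_u_v(2)[OF uv(1)] d_pos[OF uv ne] d_refl[OF uv(1)] by linarith

lemma positive_symmetric_layout: "positive_symmetric (A <+> {..<k + l + 2}) (layout d u v a)"
proof
  show "2 \<le> card (A <+> {..<k + l + 2})"
    by (simp add: card_Plus)
  have leg_pos: "0 < leg d u v a z s" if "z \<in> A" for z s
    using d_pos[of z u] d_pos[of z v] that uv by (auto simp: leg_def intro: add_pos_nonneg)
  fix i j assume ij: "i \<in> A <+> {..<k + l + 2}" "j \<in> A <+> {..<k + l + 2}"
  show "layout d u v a i j = layout d u v a j i"
    using ij by (cases i; cases j) (simp_all add: d_commute)
  show "0 < layout d u v a i j" if "i \<noteq> j"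
    using ij that by (cases i; cases j) (simp_all add: d_pos leg_pos)
next
  fix i assume "i \<in> A <+> {..<k + l + 2}"
  show "0 \<le> layout d u v a i i"
    by (cases i) auto
qed simp

text \<open>Translates positions into vertex numbers. Position \<open>k\<close> is \<open>u\<close>
  and position \<open>k + 1\<close> is \<open>v\<close>, each with path index 0; the new vertices of
  the second path start at \<open>n + k\<close>.\<close>

definition place :: "nat \<Rightarrow> nat + nat \<Rightarrow> nat" where
  "place k i = (case i of Inl z \<Rightarrow> z
    | Inr s \<Rightarrow> if s \<le> k then path_vertex n u (k - s) else path_vertex (n + k) v (s - k - 1))"

lemma verts_two: "pverts (add_two_paths G u v k l) = {0..<n + k + l}"
  unfolding add_two_paths_def by (intro pverts_add_path verts)

lemma place_less:
  assumes "i \<in> A <+> {..<k + l + 2}"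
  shows "place k i < n + k + l"
  using assms uv by (cases i) (auto simp: place_def path_vertex_def)

text \<open>Both path extensions have explicit metrics; composing them and splitting by the kinds of
  \<open>i\<close> and \<open>j\<close> gives the layout.\<close>

lemma graph_dist_two_paths:
  assumes i: "i \<in> A <+> {..<k + l + 2}" and j: "j \<in> A <+> {..<k + l + 2}"
  shows "graph_dist (add_two_paths G u v k l) (place k i) (place k j) = layout d u v k i j"
proof -
  let ?d = "ext_dist (n + k) v (ext_dist n u d)"
  have "graph_metric (add_two_paths G u v k l) ?d"
    unfolding add_two_paths_def
    by (intro graph_metric_add_path pverts_add_path verts graph_metric_axioms uv trans_less_add1)
  then have "graph_dist (add_two_paths G u v k l) (place k i) (place k j) = real (?d (place k i) (place k j))"
    by (rule graph_metric_graph_dist) (use place_less[OF i] place_less[OF j] in \<open>simp_all add: verts_two\<close>)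
  also have "\<dots> = layout d u v k i j"
  proof -
    have pv: "path_vertex n u (k - s) < n + k" for s
      using uv by (auto simp: path_vertex_def)
    have lt: "z < n + k" if "z < n" for z
      using that by simp
    have d_vu: "d v u = 1"
      using d_commute[OF uv] d_uv by simp
    have d_sym: "d u z = d z u" "d v z = d z v" if "z < n" for z
      using d_commute that uv by blast+
    note ext = ext_dist_old ext_dist_path uv lt pv d_refl d_uv d_vu d_sym place_def leg_def of_nat_diff
    show ?thesis
    proof (cases i)
      case (Inl z)
      with i have "z < n" by simp
      then show ?thesis
        using Inl j by (cases j) (auto simp: ext)
    next
      case (Inr s)
      then show ?thesis
        using i j by (cases j) (auto simp: ext)
    qed
  qed
  finally show ?thesis .
qed

text \<open>Injectivity comes from the metric: distinct indices have positive layout distance, so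
  they cannot share a vertex. Counting gives surjectivity.\<close>

lemma place_bij:
  "bij_betw (place k) (A <+> {..<k + l + 2}) {..<card (pverts (add_two_paths G u v k l))}"
proof -
  let ?I = "A <+> {..<k + l + 2}" and ?H = "add_two_paths G u v k l"
  interpret positive_symmetric ?I "layout d u v k"
    by (rule positive_symmetric_layout)
  have "inj_on (place k) ?I"
  proof (rule inj_onI, rule ccontr)
    fix i j assume ij: "i \<in> ?I" "j \<in> ?I" "place k i = place k j" "i \<noteq> j"
    have "layout d u v k i j = layout d u v k j j"
      using graph_dist_two_paths[OF ij(1,2)] graph_dist_two_paths[OF ij(2,2)] ij(3) by simp
    moreover have "layout d u v k j j = 0"
      using ij(2) d_refl by (cases j) auto
    ultimately show False
      using off_diag[OF ij(1,2,4)] by simp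
  qed
  moreover have "place k ` ?I \<subseteq> {..<n + k + l}"
    using place_less by auto
  moreover have "card ?I = n + k + l"
    using three by (simp add: card_Plus card_A)
  ultimately show ?thesis
    unfolding bij_betw_def verts_two by (simp add: card_image card_subset_eq)
qed

section \<open>Comparison of neighbouring pairs of path lengths\<close>

lemma two_paths_perron:
  obtains x where "\<And>i. i \<in> A <+> {..<k + l + 2} \<Longrightarrow> 0 < x i"
    "0 < distance_spectral_radius (add_two_paths G u v k l)"
    "\<And>i. i \<in> A <+> {..<k + l + 2} \<Longrightarrow> matvec (A <+> {..<k + l + 2}) (layout d u v k) x i =
      distance_spectral_radius (add_two_paths G u v k l) * x i"
proof -
  interpret positive_symmetric "A <+> {..<k + l + 2}" "layout d u v k"
    by (rule positive_symmetric_layout)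
  have "layout d u v k i j = graph_dist (add_two_paths G u v k l) (place k i) (place k j)"
    if "i \<in> A <+> {..<k + l + 2}" "j \<in> A <+> {..<k + l + 2}" for i j
    using graph_dist_two_paths[OF that] by (rule HOL.sym)
  from distance_spectral_radius_perron[OF place_bij this] show ?thesis
    using that by metis
qed

text \<open>Equal sums \<open>k + l\<close> give both graphs the same index set, so the Perron
  vector of the first can be tested on the second.\<close>

lemma spectral_radius_shift:
  assumes pos: "\<And>i. i \<in> A <+> {..<k + l + 2} \<Longrightarrow> 0 < x i"
    and ev: "\<And>i. i \<in> A <+> {..<k + l + 2} \<Longrightarrow> matvec (A <+> {..<k + l + 2}) (layout d u v k) x i =
      distance_spectral_radius (add_two_paths G u v k l) * x i"
    and kl: "k' + l' = k + l"
    and ge: "\<And>z s. z \<in> A \<Longrightarrow> s < k + l + 2 \<Longrightarrow> \<sigma> s \<le> leg d u v k' z s - leg d u v k z s"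
    and balance: "0 \<le> (\<Sum>s<k + l + 2. \<sigma> s * x (Inr s))"
    and strict: "t < k + l + 2" "\<And>z. z \<in> A \<Longrightarrow> leg d u v k z t < leg d u v k' z t"
  shows "distance_spectral_radius (add_two_paths G u v k l)
    < distance_spectral_radius (add_two_paths G u v k' l')"
proof -
  define I where "I = A <+> {..<k + l + 2}"
  have I': "I = A <+> {..<k' + l' + 2}"
    using kl by (simp add: I_def)
  have dist: "layout d u v k' i j = graph_dist (add_two_paths G u v k' l') (place k' i) (place k' j)"
    if "i \<in> I" "j \<in> I" for i j
    using graph_dist_two_paths[OF that[unfolded I']] by (rule HOL.sym)
  have fin: "finite A"
    by simp
  note shift = layout_shift[OF fin A_ne pos ge balance strict, folded I_def]
  show ?thesis
  proof (rule distance_spectral_radius_less)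
    show "positive_symmetric I (layout d u v k)" "positive_symmetric I (layout d u v k')"
      unfolding I_def by (rule positive_symmetric_layout)+
    show "bij_betw (place k') I {..<card (pverts (add_two_paths G u v k' l'))}"
      unfolding I' by (rule place_bij)
    show "qform I (layout d u v k) x \<le> qform I (layout d u v k') x"
      by (rule shift(1))
    show "matvec I (layout d u v k) x (Inr t) \<noteq> matvec I (layout d u v k') x (Inr t)"
      by (rule shift(2))
    show "Inr t \<in> I"
      using strict(1) by (simp add: I_def)
  qed (use dist pos ev in \<open>simp_all add: I_def\<close>)
qed

text \<open>Distances from \<open>A\<close> to positions up to \<open>k\<close> grow by 1. Position
  \<open>k + 1\<close> changes from \<open>v\<close> to \<open>u\<close>, which loses at most 1 by
  adjacency; later positions lose exactly 1. The strict row is position 0, the end of the path at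
  \<open>u\<close>.\<close>

lemma shift_right:
  assumes pos: "\<And>i. i \<in> A <+> {..<k + l + 2} \<Longrightarrow> 0 < x i"
    and ev: "\<And>i. i \<in> A <+> {..<k + l + 2} \<Longrightarrow> matvec (A <+> {..<k + l + 2}) (layout d u v k) x i =
      distance_spectral_radius (add_two_paths G u v k l) * x i"
    and "1 \<le> l" and balance: "0 \<le> (\<Sum>s<k + l + 2. (if s \<le> k then 1 else - 1) * x (Inr s))"
  shows "distance_spectral_radius (add_two_paths G u v k l)
    < distance_spectral_radius (add_two_paths G u v (k + 1) (l - 1))"
proof (rule spectral_radius_shift[OF pos ev _ _ balance, of "k + 1" "l - 1" 0])
  fix z s assume "z \<in> A"
  then show "(if s \<le> k then 1 else - 1) \<le> leg d u v (k + 1) z s - leg d u v k z s"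
    using d_u_v(2)[of z] by (auto simp: leg_def)
qed (use \<open>1 \<le> l\<close> in \<open>auto simp: leg_def\<close>)

text \<open>Mirror image of \<open>shift_right\<close>: position \<open>k\<close> changes from
  \<open>u\<close> to \<open>v\<close>, and the strict row is the last position
  \<open>k + l + 1\<close>.\<close>

lemma shift_left:
  assumes pos: "\<And>i. i \<in> A <+> {..<k + l + 2} \<Longrightarrow> 0 < x i"
    and ev: "\<And>i. i \<in> A <+> {..<k + l + 2} \<Longrightarrow> matvec (A <+> {..<k + l + 2}) (layout d u v k) x i =
      distance_spectral_radius (add_two_paths G u v k l) * x i"
    and "1 \<le> k" and balance: "(\<Sum>s<k + l + 2. (if s \<le> k then 1 else - 1) * x (Inr s)) \<le> 0"
  shows "distance_spectral_radius (add_two_paths G u v k l)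
    < distance_spectral_radius (add_two_paths G u v (k - 1) (l + 1))"
proof (rule spectral_radius_shift[OF pos ev, of "k - 1" "l + 1" "\<lambda>s. - (if s \<le> k then 1 else - 1)" "k + l + 1"])
  show "0 \<le> (\<Sum>s<k + l + 2. - (if s \<le> k then 1 else - 1) * x (Inr s))"
    using balance by (simp only: mult_minus_left sum_negf neg_0_le_iff_le)
  fix z s assume "z \<in> A"
  then show "- (if s \<le> k then 1 else - 1) \<le> leg d u v (k - 1) z s - leg d u v k z s"
    using d_u_v(1)[of z] \<open>1 \<le> k\<close> by (auto simp: leg_def)
qed (use \<open>1 \<le> k\<close> in \<open>auto simp: leg_def\<close>)

text \<open>\<open>path_balance\<close> centred at \<open>u\<close>, that is, with
  \<open>a = k\<close>; its length bound \<open>m \<le> 2 * a + 1\<close> is exactly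
  \<open>l < k\<close>.\<close>

lemma longer_side_heavier:
  assumes pos: "\<And>i. i \<in> A <+> {..<k + l + 2} \<Longrightarrow> 0 < x i" and r: "0 < r"
    and ev: "\<And>i. i \<in> A <+> {..<k + l + 2} \<Longrightarrow>
      matvec (A <+> {..<k + l + 2}) (layout d u v k) x i = r * x i"
    and "l < k"
  shows "0 \<le> (\<Sum>s<k + l + 2. (if s \<le> k then 1 else - 1) * x (Inr s))"
proof -
  define m where "m = k + l + 2"
  note pos = pos[folded m_def] and ev = ev[folded m_def]
  have nonneg: "0 \<le> x (Inr s)" if "s < m" for s
    using pos[of "Inr s"] that by simp
  define c where "c = (\<Sum>z\<in>A. (real (d z u) + 1 - real (d z v)) * x (Inl z))"
  have "0 \<le> c"
    unfolding c_def
  proof (intro sum_nonneg mult_nonneg_nonneg)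
    fix z assume z: "z \<in> A"
    then show "0 \<le> real (d z u) + 1 - real (d z v)"
      using d_u_v(2)[of z] by simp
    show "0 \<le> x (Inl z)"
      using pos[of "Inl z"] z by simp
  qed
  have "r * (x (Inr (k - 1 - i)) - x (Inr (k + 1 + i))) =
      c + (\<Sum>s<m. (\<bar>real (k - 1 - i) - real s\<bar> - \<bar>real (k + 1 + i) - real s\<bar>) * x (Inr s))"
    if i: "k + 1 + i < m" for i
  proof -
    \<comment> \<open>The two legs are \<open>d z u + 1 + i\<close> and \<open>d z v + i\<close>, so
      the contribution of \<open>A\<close> does not depend on \<open>i\<close>.\<close>
    have "(\<Sum>z\<in>A. leg d u v k z (k - 1 - i) * x (Inl z)) - (\<Sum>z\<in>A. leg d u v k z (k + 1 + i) * x (Inl z)) = c"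
      unfolding c_def sum_subtractf[symmetric]
      by (rule sum.cong) (use i \<open>l < k\<close> in \<open>auto simp: m_def leg_def of_nat_diff algebra_simps\<close>)
    moreover have "k - 1 - i < m"
      using i by simp
    ultimately show ?thesis
      using ev[of "Inr (k - 1 - i)"] ev[of "Inr (k + 1 + i)"] i
      by (simp add: matvec_layout_path left_diff_distrib right_diff_distrib sum_subtractf)
  qed
  then have "0 \<le> (\<Sum>s<m. (if s < k then 1 else if k < s then - 1 else 0) * x (Inr s))"
    using \<open>l < k\<close> nonneg by (intro path_balance[OF r \<open>0 \<le> c\<close>]) (simp_all add: m_def)
  \<comment> \<open>Position \<open>k\<close>, which has coefficient 0 in the symmetric balance,
    counts for the side of \<open>u\<close>.\<close>
  also have "\<dots> \<le> (\<Sum>s<m. (if s \<le> k then 1 else - 1) * x (Inr s))"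
    by (intro sum_mono mult_right_mono) (use nonneg in auto)
  also have "\<dots> = (\<Sum>s<k + l + 2. (if s \<le> k then 1 else - 1) * x (Inr s))"
    by (simp only: m_def)
  finally show ?thesis .
qed

end

theorem theorem1p1:
  fixes G :: "nat pair_pre_digraph" and n u v k l :: nat
  assumes "pair_graph G" and "pverts G = {0..<n}" and "Digraph_Component.connected (with_proj G)"
    and "(u, v) \<in> parcs G" and "n \<ge> 3"
  shows "(k > l \<and> l \<ge> 1 \<longrightarrow>
            distance_spectral_radius (add_two_paths G u v k l)
              < distance_spectral_radius (add_two_paths G u v (k + 1) (l - 1))) \<and>
         (k = l \<and> l \<ge> 1 \<longrightarrow>
            distance_spectral_radius (add_two_paths G u v k l)
              < distance_spectral_radius (add_two_paths G u v (k + 1) (l - 1)) \<or>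
            distance_spectral_radius (add_two_paths G u v k l)
              < distance_spectral_radius (add_two_paths G u v (k - 1) (l + 1)))"
proof -
  interpret G: pair_graph G by (rule assms(1))
  obtain d where d: "graph_metric G d"
    using connected_graph_metric[OF assms(1,3)] .
  have "(v, u) \<in> parcs G"
    using G.sym_arcs assms(4) by (simp add: symmetric_def sym_def)
  moreover have "u \<noteq> v"
    using G.pair_no_loops[OF assms(4)] by simp
  ultimately interpret rooted_edge G d n u v
    using d assms by (simp add: rooted_edge_def rooted_edge_axioms_def)
  obtain x where pos: "\<And>i. i \<in> A <+> {..<k + l + 2} \<Longrightarrow> 0 < x i"
    and r: "0 < distance_spectral_radius (add_two_paths G u v k l)"
    and ev: "\<And>i. i \<in> A <+> {..<k + l + 2} \<Longrightarrow> matvec (A <+> {..<k + l + 2}) (layout d u v k) x i =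
      distance_spectral_radius (add_two_paths G u v k l) * x i"
    using two_paths_perron[of k l] by metis
  let ?balance = "\<Sum>s<k + l + 2. (if s \<le> k then 1 else - 1) * x (Inr s)"
  show ?thesis
  proof (intro conjI impI)
    assume "k > l \<and> l \<ge> 1"
    then show "distance_spectral_radius (add_two_paths G u v k l)
        < distance_spectral_radius (add_two_paths G u v (k + 1) (l - 1))"
      using shift_right[OF pos ev] longer_side_heavier[OF pos r ev] by simp
  next
    \<comment> \<open>Whichever sign \<open>?balance\<close> has, one of the two shifts
      applies.\<close>
    assume "k = l \<and> l \<ge> 1"
    then show "distance_spectral_radius (add_two_paths G u v k l)
          < distance_spectral_radius (add_two_paths G u v (k + 1) (l - 1)) \<or>
        distance_spectral_radius (add_two_paths G u v k l)
          < distance_spectral_radius (add_two_paths G u v (k - 1) (l + 1))"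
      using shift_right[OF pos ev] shift_left[OF pos ev] linear[of 0 ?balance] by auto
  qed
qed

end
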